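(* Let $\mathbb K$ be an algebraically closed field of characteristic $0$, let $(L,[\,,],\{\,,,\})$ be a Lie-Yamaguti algebra over $\mathbb K$, let $n\ge1$, and let $(F_1,G_1),\dots,(F_n,G_n)\in C^{(2,3)}(L;L)$ be a deformation of $L$ of order $n$. Define, for $a,b,c,d,e\in L$, with all sums over $i+j=n+1$, $i,j\ge1$, $$P(a,b,c)=\sum\sum_{\circlearrowleft(a,b,c)}F_i(F_j(a,b),c),\qquad Q(a,b,c,d)=\sum\sum_{\circlearrowleft(a,b,c)}G_i(F_j(a,b),c,d),$$ $$R(a,b,c,d)=\sum\Big(G_i(a,b,F_j(c,d))-F_i(G_j(a,b,c),d)-F_i(c,G_j(a,b,d))\Big),$$ $$S(a,b,c,d,e)=\sum\Big(G_i(a,b,G_j(c,d,e))-G_i(G_j(a,b,c),d,e)-G_i(c,G_j(a,b,d),e)-G_i(c,d,G_j(a,b,e))\Big).$$ Then the cohomology class of $\big((P,Q),(R,S)\big)$ in $H^{((3,4),(4,5))}(L;L)$ vanishes if and only if the given $n$-th order deformation extends to an $(n+1)$-th order deformation, i.e. there is $(F_{n+1},G_{n+1})\in C^{(2,3)}(L;L)$ such that $(F_1,G_1),\dots,(F_n,G_n),(F_{n+1},G_{n+1})$ is a deformation of $L$ of order $n+1$.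
   Context: A Lie-Yamaguti algebra $(L,[\,,],\{\,,,\})$ over $\mathbb K$ is a $\mathbb K$-vector space with a bilinear map $[\,,]:L\times L\to L$ and a trilinear map $\{\,,,\}:L\times L\times L\to L$ such that for all $x,y,z,u,v,w\in L$ (with $\sum_{\circlearrowleft(x,y,z)}$ the sum over cyclic permutations of $x,y,z$): (LY1) $[x,y]=-[y,x]$; (LY2) $\{x,y,z\}=-\{y,x,z\}$; (LY3) $\sum_{\circlearrowleft(x,y,z)}([[x,y],z]+\{x,y,z\})=0$; (LY4) $\sum_{\circlearrowleft(x,y,z)}\{[x,y],z,u\}=0$; (LY5) $\{x,y,[u,v]\}=[\{x,y,u\},v]+[u,\{x,y,v\}]$; (LY6) $\{x,y,\{u,v,w\}\}=\{\{x,y,u\},v,w\}+\{u,\{x,y,v\},w\}+\{u,v,\{x,y,w\}\}$. Cochains (adjoint coefficients). For $p\ge1$, $C^{2p}(L;L)$ is the space of $2p$-linear maps $f:L^{2p}\to L$, and $C^{2p+1}(L;L)$ the space of $(2p+1)$-linear maps $g:L^{2p+1}\to L$, which vanish whenever $x_{2i-1}=x_{2i}$ for some $1\le i\le p$. Put $C^{(2p,2p+1)}(L;L)=C^{2p}(L;L)\times C^{2p+1}(L;L)$ and $C^{(3,4)}(L;L)=C^3(L;L)\times C^4(L;L)$. (Thus elements of $C^3$ vanish when $x_1=x_2$, and elements of $C^4$ vanish when $x_1=x_2$ and when $x_3=x_4$.) For $(f,g)\in C^{(2,3)}(L;L)$ put $\delta(f,g)=(\delta_If,\delta_{II}g)\in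 C^{(4,5)}(L;L)$ and $\delta^*(f,g)=(\delta^*_If,\delta^*_{II}g)\in C^{(3,4)}(L;L)$, where (each component may depend on both $f$ and $g$) $\delta_If(a,b,c,d)=-[c,g(a,b,d)]+[d,g(a,b,c)]+g(a,b,[c,d])+\{a,b,f(c,d)\}-f(\{a,b,c\},d)-f(c,\{a,b,d\})$; $\delta_{II}g(a,b,c,d,e)=-\{g(a,b,c),d,e\}+\{g(a,b,d),c,e\}+\{a,b,g(c,d,e)\}-\{c,d,g(a,b,e)\}-g(\{a,b,c\},d,e)-g(c,\{a,b,d\},e)-g(c,d,\{a,b,e\})+g(a,b,\{c,d,e\})$; $\delta^*_If(a,b,c)=-[a,f(b,c)]-[b,f(c,a)]-[c,f(a,b)]+f([a,b],c)+f([b,c],a)+f([c,a],b)+g(a,b,c)+g(b,c,a)+g(c,a,b)$; $\delta^*_{II}g(a,b,c,d)=\{f(b,c),a,d\}+\{f(c,a),b,d\}+\{f(a,b),c,d\}+g([a,b],c,d)+g([b,c],a,d)+g([c,a],b,d)$. For $(f,g)\in C^{(4,5)}(L;L)$ put $\delta(f,g)=(\delta_If,\delta_{II}g)\in C^{(6,7)}(L;L)$, where $\delta_If(x_1,\dots,x_6)=[x_5,g(x_1,x_2,x_3,x_4,x_6)]-[x_6,g(x_1,\dots,x_5)]-g(x_1,x_2,x_3,x_4,[x_5,x_6])+\{x_1,x_2,f(x_3,x_4,x_5,x_6)\}-\{x_3,x_4,f(x_1,x_2,x_5,x_6)\}-\sum_{j=3}^{6}f(x_3,\dots,\{x_1,x_2,x_j\},\dots,x_6)+\sum_{j=5}^{6}f(x_1,x_2,\dots,\{x_3,x_4,x_j\},\dots,x_6)$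 (in the first sum the arguments are $x_3,\dots,x_6$ with $x_j$ replaced by $\{x_1,x_2,x_j\}$; in the second $x_1,x_2,x_5,x_6$ with $x_j$ replaced by $\{x_3,x_4,x_j\}$); $\delta_{II}g(x_1,\dots,x_7)=\{g(x_1,\dots,x_5),x_6,x_7\}-\{g(x_1,x_2,x_3,x_4,x_6),x_5,x_7\}+\{x_1,x_2,g(x_3,\dots,x_7)\}-\{x_3,x_4,g(x_1,x_2,x_5,x_6,x_7)\}+\{x_5,x_6,g(x_1,x_2,x_3,x_4,x_7)\}-\sum_{j=3}^{7}g(x_3,\dots,\{x_1,x_2,x_j\},\dots,x_7)+\sum_{j=5}^{7}g(x_1,x_2,\dots,\{x_3,x_4,x_j\},\dots,x_7)-g(x_1,x_2,x_3,x_4,\{x_5,x_6,x_7\})$ (first sum: arguments $x_3,\dots,x_7$ with $x_j$ replaced; second sum: arguments $x_1,x_2,x_5,x_6,x_7$ with $x_j$ replaced). Deformation cohomology. In the complex $C^{(2,3)}(L;L)\xrightarrow{(\delta^*,\delta)}C^{(3,4)}(L;L)\times C^{(4,5)}(L;L)\xrightarrow{(0,\delta)}C^{(6,7)}(L;L)$, where $(0,\delta)(\alpha,\beta)=\delta\beta$, set $H^{((3,4),(4,5))}(L;L)=\mathrm{Ker}(0,\delta)/\mathrm{Im}(\delta^*,\delta)$. (The element $((P,Q),(R,S))$ of the claim lies in $\mathrm{Ker}(0,\delta)$, so it has a class.) Deformation of order $n$: cochains $(F_\nu,G_\nu)\in C^{(2,3)}(L;L)$, $1\le\nu\le n$, such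 that for every $1\le\nu\le n$ and all $a,b,c,d,e\in L$ (sums over $i+j=\nu$, $i,j>0$; on the right the components of $\delta^*(F_\nu,G_\nu)$ and $\delta(F_\nu,G_\nu)$): $\sum\sum_{\circlearrowleft(a,b,c)}F_i(F_j(a,b),c)=-\delta^*_IF_\nu(a,b,c)$; $\sum\sum_{\circlearrowleft(a,b,c)}G_i(F_j(a,b),c,d)=-\delta^*_{II}G_\nu(a,b,c,d)$; $\sum\big(G_i(a,b,F_j(c,d))-F_i(G_j(a,b,c),d)-F_i(c,G_j(a,b,d))\big)=-\delta_IF_\nu(a,b,c,d)$; $\sum\big(G_i(a,b,G_j(c,d,e))-G_i(G_j(a,b,c),d,e)-G_i(c,G_j(a,b,d),e)-G_i(c,d,G_j(a,b,e))\big)=-\delta_{II}G_\nu(a,b,c,d,e)$.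
   Formalization: In C^(3,4) the 4-linear component is only required to vanish when x1=x2, not also when x3=x4, because Q and the second component of δ* need not vanish when x3=x4, so the class would otherwise be undefined. *)

theory Defs
  imports
    "HOL-Computational_Algebra.Polynomial"
    "HOL-Library.Function_Algebras"
    "HOL-Library.Product_Plus"
    "HOL-Library.Set_Algebras"
begin

(* The underlying space of L is the whole type 'v with scalar multiplication s over the field 'k.
   Cochains are curried functions; they are added pointwise (Function_Algebras) and pairs of
   cochains componentwise (Product_Plus). The qualifier in Vector_Spaces.linear is needed because
   the short name denotes real-linearity. *)

definition mlin2 :: "('k::field \<Rightarrow> 'v::ab_group_add \<Rightarrow> 'v) \<Rightarrow> ('v \<Rightarrow> 'v \<Rightarrow> 'v) \<Rightarrow> bool" where
  "mlin2 s f \<longleftrightarrow>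
     (\<forall>y. Vector_Spaces.linear s s (\<lambda>x. f x y)) \<and> (\<forall>x. Vector_Spaces.linear s s (f x))"

definition mlin3 ::
  "('k::field \<Rightarrow> 'v::ab_group_add \<Rightarrow> 'v) \<Rightarrow> ('v \<Rightarrow> 'v \<Rightarrow> 'v \<Rightarrow> 'v) \<Rightarrow> bool" where
  "mlin3 s f \<longleftrightarrow>
     (\<forall>y z. Vector_Spaces.linear s s (\<lambda>x. f x y z)) \<and> (\<forall>x. mlin2 s (f x))"

definition mlin4 ::
  "('k::field \<Rightarrow> 'v::ab_group_add \<Rightarrow> 'v) \<Rightarrow> ('v \<Rightarrow> 'v \<Rightarrow> 'v \<Rightarrow> 'v \<Rightarrow> 'v) \<Rightarrow> bool" where
  "mlin4 s f \<longleftrightarrow>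
     (\<forall>y z u. Vector_Spaces.linear s s (\<lambda>x. f x y z u)) \<and> (\<forall>x. mlin3 s (f x))"

definition mlin5 ::
  "('k::field \<Rightarrow> 'v::ab_group_add \<Rightarrow> 'v) \<Rightarrow> ('v \<Rightarrow> 'v \<Rightarrow> 'v \<Rightarrow> 'v \<Rightarrow> 'v \<Rightarrow> 'v) \<Rightarrow> bool" where
  "mlin5 s f \<longleftrightarrow>
     (\<forall>y z u v. Vector_Spaces.linear s s (\<lambda>x. f x y z u v)) \<and> (\<forall>x. mlin4 s (f x))"

definition cyclic_sum :: "('v \<Rightarrow> 'v \<Rightarrow> 'v \<Rightarrow> 'w::ab_group_add) \<Rightarrow> 'v \<Rightarrow> 'v \<Rightarrow> 'v \<Rightarrow> 'w" where
  "cyclic_sum h x y z = h x y z + h y z x + h z x y"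

locale lie_yamaguti = vector_space s
  for s :: "'k::field \<Rightarrow> 'v::ab_group_add \<Rightarrow> 'v" +
  fixes br :: "'v \<Rightarrow> 'v \<Rightarrow> 'v" and tr :: "'v \<Rightarrow> 'v \<Rightarrow> 'v \<Rightarrow> 'v"
  assumes br_bilinear: "mlin2 s br"
    and tr_trilinear: "mlin3 s tr"
    and LY1: "br x y = - br y x"
    and LY2: "tr x y z = - tr y x z"
    and LY3: "cyclic_sum (\<lambda>x y z. br (br x y) z + tr x y z) x y z = 0"
    and LY4: "cyclic_sum (\<lambda>x y z. tr (br x y) z u) x y z = 0"
    and LY5: "tr x y (br u v) = br (tr x y u) v + br u (tr x y v)"
    and LY6: "tr x y (tr u v w) = tr (tr x y u) v w + tr u (tr x y v) w + tr u v (tr x y w)"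


definition C2 :: "('k::field \<Rightarrow> 'v::ab_group_add \<Rightarrow> 'v) \<Rightarrow> ('v \<Rightarrow> 'v \<Rightarrow> 'v) set" where
  "C2 s = {f. mlin2 s f \<and> (\<forall>x. f x x = 0)}"

definition C3 :: "('k::field \<Rightarrow> 'v::ab_group_add \<Rightarrow> 'v) \<Rightarrow> ('v \<Rightarrow> 'v \<Rightarrow> 'v \<Rightarrow> 'v) set" where
  "C3 s = {f. mlin3 s f \<and> (\<forall>x y. f x x y = 0)}"

definition C4 :: "('k::field \<Rightarrow> 'v::ab_group_add \<Rightarrow> 'v) \<Rightarrow> ('v \<Rightarrow> 'v \<Rightarrow> 'v \<Rightarrow> 'v \<Rightarrow> 'v) set" where
  "C4 s = {f. mlin4 s f \<and> (\<forall>x y z. f x x y z = 0) \<and> (\<forall>x y z. f x y z z = 0)}"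

definition C5 ::
  "('k::field \<Rightarrow> 'v::ab_group_add \<Rightarrow> 'v) \<Rightarrow> ('v \<Rightarrow> 'v \<Rightarrow> 'v \<Rightarrow> 'v \<Rightarrow> 'v \<Rightarrow> 'v) set" where
  "C5 s = {f. mlin5 s f \<and> (\<forall>x y z u. f x x y z u = 0) \<and> (\<forall>x y z u. f x y z z u = 0)}"

(* The target of the second component of delta^*. For (f,g) in C2 x C3 that component
     {f(b,c),a,d} + {f(c,a),b,d} + {f(a,b),c,d} + g([a,b],c,d) + g([b,c],a,d) + g([c,a],b,d)
   vanishes for a = b but in general not for c = d (take g = 0, f(b,c) = f(a,b) = 0, c = d; the
   value is {f(c,a),b,c}). Hence delta^* does not map into C3 x C4 with the C4 above; its actual
   target has 4-linear maps that are only required to vanish when the first two arguments agree. *)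
definition C4_star ::
  "('k::field \<Rightarrow> 'v::ab_group_add \<Rightarrow> 'v) \<Rightarrow> ('v \<Rightarrow> 'v \<Rightarrow> 'v \<Rightarrow> 'v \<Rightarrow> 'v) set" where
  "C4_star s = {f. mlin4 s f \<and> (\<forall>x y z. f x x y z = 0)}"

definition C23 where "C23 s = C2 s \<times> C3 s"
definition C34 where "C34 s = C3 s \<times> C4_star s"
definition C45 where "C45 s = C4 s \<times> C5 s"


definition dI_23 where
  "dI_23 br tr f g a b c d =
     - br c (g a b d) + br d (g a b c) + g a b (br c d)
     + tr a b (f c d) - f (tr a b c) d - f c (tr a b d)"
  for br :: "'v::ab_group_add \<Rightarrow> 'v \<Rightarrow> 'v"

definition dII_23 where
  "dII_23 tr g a b c d e =
     - tr (g a b c) d e + tr (g a b d) c e + tr a b (g c d e) - tr c d (g a b e)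
     - g (tr a b c) d e - g c (tr a b d) e - g c d (tr a b e) + g a b (tr c d e)"
  for tr :: "'v::ab_group_add \<Rightarrow> 'v \<Rightarrow> 'v \<Rightarrow> 'v"

definition dI_star where
  "dI_star br f g a b c =
     - br a (f b c) - br b (f c a) - br c (f a b)
     + f (br a b) c + f (br b c) a + f (br c a) b
     + g a b c + g b c a + g c a b"
  for br :: "'v::ab_group_add \<Rightarrow> 'v \<Rightarrow> 'v"

definition dII_star where
  "dII_star br tr f g a b c d =
     tr (f b c) a d + tr (f c a) b d + tr (f a b) c d
     + g (br a b) c d + g (br b c) a d + g (br c a) b d"
  for br :: "'v::ab_group_add \<Rightarrow> 'v \<Rightarrow> 'v"

definition dI_45 where
  "dI_45 br tr f g x1 x2 x3 x4 x5 x6 =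
     br x5 (g x1 x2 x3 x4 x6) - br x6 (g x1 x2 x3 x4 x5) - g x1 x2 x3 x4 (br x5 x6)
     + tr x1 x2 (f x3 x4 x5 x6) - tr x3 x4 (f x1 x2 x5 x6)
     - (f (tr x1 x2 x3) x4 x5 x6 + f x3 (tr x1 x2 x4) x5 x6
        + f x3 x4 (tr x1 x2 x5) x6 + f x3 x4 x5 (tr x1 x2 x6))
     + (f x1 x2 (tr x3 x4 x5) x6 + f x1 x2 x5 (tr x3 x4 x6))"
  for br :: "'v::ab_group_add \<Rightarrow> 'v \<Rightarrow> 'v"

definition dII_45 where
  "dII_45 tr g x1 x2 x3 x4 x5 x6 x7 =
     tr (g x1 x2 x3 x4 x5) x6 x7 - tr (g x1 x2 x3 x4 x6) x5 x7
     + tr x1 x2 (g x3 x4 x5 x6 x7) - tr x3 x4 (g x1 x2 x5 x6 x7) + tr x5 x6 (g x1 x2 x3 x4 x7)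
     - (g (tr x1 x2 x3) x4 x5 x6 x7 + g x3 (tr x1 x2 x4) x5 x6 x7 + g x3 x4 (tr x1 x2 x5) x6 x7
        + g x3 x4 x5 (tr x1 x2 x6) x7 + g x3 x4 x5 x6 (tr x1 x2 x7))
     + (g x1 x2 (tr x3 x4 x5) x6 x7 + g x1 x2 x5 (tr x3 x4 x6) x7 + g x1 x2 x5 x6 (tr x3 x4 x7))
     - g x1 x2 x3 x4 (tr x5 x6 x7)"
  for tr :: "'v::ab_group_add \<Rightarrow> 'v \<Rightarrow> 'v \<Rightarrow> 'v"

definition delta_23 where
  "delta_23 br tr = (\<lambda>(f, g). (dI_23 br tr f g, dII_23 tr g))"

definition delta_star where
  "delta_star br tr = (\<lambda>(f, g). (dI_star br f g, dII_star br tr f g))"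

definition delta_45 where
  "delta_45 br tr = (\<lambda>(f, g). (dI_45 br tr f g, dII_45 tr g))"

definition cocycles where
  "cocycles s br tr = {(\<alpha>, \<beta>). \<alpha> \<in> C34 s \<and> \<beta> \<in> C45 s \<and> delta_45 br tr \<beta> = 0}"

definition coboundaries where
  "coboundaries s br tr = (\<lambda>c. (delta_star br tr c, delta_23 br tr c)) ` C23 s"

(* The coset x + Im(delta^*, delta). As a set it depends only on the image, not on the choice of the
   spaces C34 and C45 in the definition of cocycles. *)
definition cohomology_class where
  "cohomology_class s br tr x = x +o coboundaries s br tr"

definition cohomology where
  "cohomology s br tr = cohomology_class s br tr ` cocycles s br tr"


definition splits :: "nat \<Rightarrow> (nat \<times> nat) set" where
  "splits m = {(i, j). i + j = m \<and> i > 0 \<and> j > 0}"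

definition quad_P ::
  "(nat \<Rightarrow> 'v \<Rightarrow> 'v \<Rightarrow> 'v::ab_group_add) \<Rightarrow> nat \<Rightarrow> 'v \<Rightarrow> 'v \<Rightarrow> 'v \<Rightarrow> 'v" where
  "quad_P F m a b c =
     (\<Sum>(i, j)\<in>splits m. cyclic_sum (\<lambda>a b c. F i (F j a b) c) a b c)"

definition quad_Q ::
  "(nat \<Rightarrow> 'v \<Rightarrow> 'v \<Rightarrow> 'v::ab_group_add) \<Rightarrow> (nat \<Rightarrow> 'v \<Rightarrow> 'v \<Rightarrow> 'v \<Rightarrow> 'v) \<Rightarrow>
     nat \<Rightarrow> 'v \<Rightarrow> 'v \<Rightarrow> 'v \<Rightarrow> 'v \<Rightarrow> 'v" where
  "quad_Q F G m a b c d =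
     (\<Sum>(i, j)\<in>splits m. cyclic_sum (\<lambda>a b c. G i (F j a b) c d) a b c)"

definition quad_R ::
  "(nat \<Rightarrow> 'v \<Rightarrow> 'v \<Rightarrow> 'v::ab_group_add) \<Rightarrow> (nat \<Rightarrow> 'v \<Rightarrow> 'v \<Rightarrow> 'v \<Rightarrow> 'v) \<Rightarrow>
     nat \<Rightarrow> 'v \<Rightarrow> 'v \<Rightarrow> 'v \<Rightarrow> 'v \<Rightarrow> 'v" where
  "quad_R F G m a b c d =
     (\<Sum>(i, j)\<in>splits m. G i a b (F j c d) - F i (G j a b c) d - F i c (G j a b d))"

definition quad_S ::
  "(nat \<Rightarrow> 'v \<Rightarrow> 'v \<Rightarrow> 'v \<Rightarrow> 'v::ab_group_add) \<Rightarrow>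
     nat \<Rightarrow> 'v \<Rightarrow> 'v \<Rightarrow> 'v \<Rightarrow> 'v \<Rightarrow> 'v \<Rightarrow> 'v" where
  "quad_S G m a b c d e =
     (\<Sum>(i, j)\<in>splits m. G i a b (G j c d e) - G i (G j a b c) d e
        - G i c (G j a b d) e - G i c d (G j a b e))"

(* Only the values of F and G at the indices 1, ..., n matter. *)
definition deformation where
  "deformation s br tr n F G \<longleftrightarrow>
     (\<forall>\<nu>\<in>{1..n}.
        (F \<nu>, G \<nu>) \<in> C23 s \<and>
        (\<forall>a b c. quad_P F \<nu> a b c = - dI_star br (F \<nu>) (G \<nu>) a b c) \<and>
        (\<forall>a b c d. quad_Q F G \<nu> a b c d = - dII_star br tr (F \<nu>) (G \<nu>) a b c d) \<and>
        (\<forall>a b c d. quad_R F G \<nu> a b c d = - dI_23 br tr (F \<nu>) (G \<nu>) a b c d) \<and>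
        (\<forall>a b c d e. quad_S G \<nu> a b c d e = - dII_23 tr (G \<nu>) a b c d e))"

end

theory Submission
  imports Defs
begin

text \<open>
  The heart of the matter is that the obstruction is a cocycle. Think of the deformation as the
  pair of \<open>t\<close>-linear operations \<open>f = [ , ] + F\<^sub>1 t + \<dots> + F\<^sub>n t^n\<close> and
  \<open>g = { , , } + G\<^sub>1 t + \<dots> + G\<^sub>n t^n\<close> on \<open>L[[t]]\<close>, and write \<open>D\<^sub>a\<^sub>b = g(a, b, -)\<close>. The axioms
  LY5 and LY6 say that \<open>D\<^sub>a\<^sub>b\<close> is a derivation of \<open>f\<close> and of \<open>g\<close>; let \<open>R(a, b, -, -)\<close> and
  \<open>S(a, b, -, -, -)\<close> be the amounts by which this fails. The deformation equations of order at most
  \<open>n\<close> say that \<open>R\<close> and \<open>S\<close> are divisible by \<open>t^(n+1)\<close>, and their coefficients at \<open>t^(n+1)\<close> are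
  the second component \<open>(quad_R, quad_S)\<close> of the obstruction.

  By its very definition \<open>S\<close> also measures the failure of
  \<open>[D\<^sub>a\<^sub>b, D\<^sub>c\<^sub>d] = D\<^bsub>g(a,b,c),d\<^esub> + D\<^bsub>c,g(a,b,d)\<^esub>\<close>. Endomorphisms act on bilinear and on trilinear maps,
  and the commutator of two endomorphisms acts as the commutator of the two actions
  (\<open>leibniz2_commutator\<close>, \<open>leibniz3_commutator\<close>). Applying this to \<open>D\<^sub>a\<^sub>b\<close>, \<open>D\<^sub>c\<^sub>d\<close> and to \<open>f\<close>, \<open>g\<close>
  gives identities between \<open>f\<close>, \<open>g\<close>, \<open>R\<close> and \<open>S\<close> that hold for all multiadditive \<open>f\<close> and \<open>g\<close>
  (\<open>LY5_defect_identity\<close>, \<open>LY6_defect_identity\<close>). They are homogeneous of degree one in \<open>(R, S)\<close>, so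
  at the lowest order \<open>t^(n+1)\<close> only the undeformed operations occur next to \<open>R\<close> and \<open>S\<close>, and what
  remains is the equation \<open>\<delta>(quad_R, quad_S) = 0\<close> (\<open>LY5_coeff_cocycle\<close>, \<open>LY6_coeff_cocycle\<close>).
  The complex puts no closedness condition on \<open>(P, Q)\<close>.

  For the equivalence, the equations of order \<open>n + 1\<close> for an extension by \<open>(f, g)\<close> say that the
  obstruction is \<open>-(\<delta>\<^sup>*, \<delta>)(f, g)\<close>, since the quadratic expressions of order \<open>n + 1\<close> contain only
  terms of order at most \<open>n\<close>. As the coboundaries form a subgroup, such a pair exists exactly when
  the class vanishes.
\<close>

section \<open>Formal power series with coefficients in an abelian group\<close>

text \<open>A power series \<open>\<Sum> x\<^sub>m t^m\<close> is the sequence of its coefficients; \<open>shift\<close> is the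
  multiplication by \<open>t\<close>.\<close>
definition const_series :: "'a::zero \<Rightarrow> nat \<Rightarrow> 'a" where
  "const_series a m = (if m = 0 then a else 0)"

definition shift :: "(nat \<Rightarrow> 'a::zero) \<Rightarrow> nat \<Rightarrow> 'a" where
  "shift x m = (case m of 0 \<Rightarrow> 0 | Suc k \<Rightarrow> x k)"

text \<open>The Cauchy product of a series of maps with a series of arguments. As \<open>'b\<close> may itself be a type of
  functions, iterating it extends a series of curried maps of any arity to power series.\<close>
definition series_app :: "(nat \<Rightarrow> 'a \<Rightarrow> 'b::comm_monoid_add) \<Rightarrow> (nat \<Rightarrow> 'a) \<Rightarrow> nat \<Rightarrow> 'b" where
  "series_app H x m = (\<Sum>i\<le>m. H (m - i) (x i))"

lemma sum_fun_apply: "(\<Sum>i\<in>I. h i) v = (\<Sum>i\<in>I. h i v)"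
  for h :: "'i \<Rightarrow> 'a \<Rightarrow> 'b::comm_monoid_add"
  by (induction I rule: infinite_finite_induct) auto

lemma series_app_add:
  assumes "\<And>i. additive (H i)"
  shows "series_app H (x + y) = series_app H x + series_app H y"
  by (rule ext) (simp add: series_app_def additive.add[OF assms] sum.distrib)

lemma series_app_add_left: "series_app (H + K) x = series_app H x + series_app K x"
  by (rule ext) (simp add: series_app_def sum.distrib)

lemma series_app_const:
  assumes "\<And>i. additive (H i)"
  shows "series_app H (const_series a) = (\<lambda>m. H m a)"
proof
  fix m
  have "series_app H (const_series a) m = (\<Sum>i\<in>{0}. H (m - i) (const_series a i))"
    unfolding series_app_def
    by (rule sum.mono_neutral_right) (auto simp: const_series_def additive.zero[OF assms])
  then show "series_app H (const_series a) m = H m a" by (simp add: const_series_def)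
qed

lemma series_app_shift:
  assumes "\<And>i. additive (H i)"
  shows "series_app H (shift x) = shift (series_app H x)"
proof
  show "series_app H (shift x) m = shift (series_app H x) m" for m
    by (cases m) (simp_all add: series_app_def shift_def additive.zero[OF assms] sum.atMost_Suc_shift
        del: sum.atMost_Suc)
qed

lemma series_app_shift_left: "series_app (shift H) x = shift (series_app H x)"
proof
  show "series_app (shift H) x m = shift (series_app H x) m" for m
    by (cases m) (auto simp: series_app_def shift_def Suc_diff_le intro!: sum.cong)
qed

definition t_linear :: "((nat \<Rightarrow> 'a::ab_group_add) \<Rightarrow> nat \<Rightarrow> 'b::ab_group_add) \<Rightarrow> bool" where
  "t_linear h \<longleftrightarrow> additive h \<and> (\<forall>x. h (shift x) = shift (h x))"

lemma t_linearD:
  assumes "t_linear h"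
  shows "h (x + y) = h x + h y" "h (shift x) = shift (h x)"
  using assms by (auto simp: t_linear_def additive.add)

lemma t_linear_ident: "t_linear (\<lambda>x. x)"
  by (simp add: t_linear_def additive_def)

lemma shift_diff: "shift (x - y) = shift x - shift y"
  for x y :: "nat \<Rightarrow> 'a::ab_group_add"
  by (auto simp: shift_def split: nat.split)

lemma t_linear_diff:
  "t_linear h \<Longrightarrow> t_linear k \<Longrightarrow> t_linear (\<lambda>x. h x - k x)"
  by (simp add: t_linear_def additive_def shift_diff)

text \<open>Since \<open>x = x\<^sub>0 + t x'\<close>, also \<open>h(x) = h(x\<^sub>0) + t h(x')\<close>. If \<open>h\<close> maps constants to multiples of
  \<open>t^(n+1)\<close>, induction on the order shows the same for all series, and then \<open>t h(x')\<close> does not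
  contribute to the coefficient of \<open>t^(n+1)\<close>.\<close>
lemma t_linear_lowest_coeff:
  assumes h: "t_linear h" and vanish: "\<And>v m. m \<le> n \<Longrightarrow> h (const_series v) m = 0"
  shows "h x (Suc n) = h (const_series (x 0)) (Suc n)"
proof -
  have split: "h x = h (const_series (x 0)) + shift (h (\<lambda>k. x (Suc k)))" for x
  proof -
    have "x = const_series (x 0) + shift (\<lambda>k. x (Suc k))"
      by (auto simp: const_series_def shift_def split: nat.split)
    then show ?thesis using t_linearD[OF h] by metis
  qed
  have zero: "h x m = 0" if "m \<le> n" for m x
    using that
  proof (induction m arbitrary: x)
    case 0
    then show ?case by (subst split) (simp add: vanish shift_def)
  next
    case (Suc m)
    then show ?case by (subst split) (simp add: vanish shift_def)
  qed
  show "h x (Suc n) = h (const_series (x 0)) (Suc n)"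
    by (subst split) (simp add: zero shift_def)
qed

section \<open>Action of endomorphisms on multiadditive maps\<close>

text \<open>The natural action of an endomorphism \<open>D\<close> on multiadditive maps: the result is zero exactly if
  \<open>D\<close> is a derivation.\<close>
definition leibniz2 :: "('w \<Rightarrow> 'w) \<Rightarrow> ('w \<Rightarrow> 'w \<Rightarrow> 'w::ab_group_add) \<Rightarrow> 'w \<Rightarrow> 'w \<Rightarrow> 'w" where
  "leibniz2 D f x y = D (f x y) - f (D x) y - f x (D y)"

definition leibniz3 ::
    "('w \<Rightarrow> 'w) \<Rightarrow> ('w \<Rightarrow> 'w \<Rightarrow> 'w \<Rightarrow> 'w::ab_group_add) \<Rightarrow> 'w \<Rightarrow> 'w \<Rightarrow> 'w \<Rightarrow> 'w" where
  "leibniz3 D g x y z = D (g x y z) - g (D x) y z - g x (D y) z - g x y (D z)"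

text \<open>The action is a representation of the Lie algebra of endomorphisms: all terms in which \<open>D\<close>
  and \<open>E\<close> act in different places occur in both orders and cancel.\<close>
lemma leibniz2_commutator:
  assumes "additive D" "additive E" "\<And>y. additive (\<lambda>x. f x y)" "\<And>x. additive (f x)"
  shows "leibniz2 D (leibniz2 E f) x y - leibniz2 E (leibniz2 D f) x y =
    leibniz2 (\<lambda>v. D (E v) - E (D v)) f x y"
  by (simp add: leibniz2_def additive.diff[OF assms(1)] additive.diff[OF assms(2)]
      additive.diff[OF assms(3)] additive.diff[OF assms(4)])

lemma leibniz3_commutator:
  assumes "additive D" "additive E" "\<And>y z. additive (\<lambda>x. g x y z)"
    "\<And>x z. additive (\<lambda>y. g x y z)" "\<And>x y. additive (g x y)"
  shows "leibniz3 D (leibniz3 E g) x y z - leibniz3 E (leibniz3 D g) x y z =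
    leibniz3 (\<lambda>v. D (E v) - E (D v)) g x y z"
  by (simp add: leibniz3_def additive.diff[OF assms(1)] additive.diff[OF assms(2)]
      additive.diff[OF assms(3)] additive.diff[OF assms(4)] additive.diff[OF assms(5)])

section \<open>Defects of LY5 and LY6 for power series of operations\<close>

definition ext2 :: "(nat \<Rightarrow> 'v \<Rightarrow> 'v \<Rightarrow> 'v::ab_group_add) \<Rightarrow> (nat \<Rightarrow> 'v) \<Rightarrow> (nat \<Rightarrow> 'v) \<Rightarrow> nat \<Rightarrow> 'v"
  where "ext2 F x y = series_app (series_app F x) y"

definition ext3 :: "(nat \<Rightarrow> 'v \<Rightarrow> 'v \<Rightarrow> 'v \<Rightarrow> 'v::ab_group_add) \<Rightarrow>
    (nat \<Rightarrow> 'v) \<Rightarrow> (nat \<Rightarrow> 'v) \<Rightarrow> (nat \<Rightarrow> 'v) \<Rightarrow> nat \<Rightarrow> 'v"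
  where "ext3 G x y z = series_app (series_app (series_app G x) y) z"

text \<open>The full convolution sum of order \<open>m\<close> consists of the two terms in which one index is zero, which
  make up the linear part of the deformation equations, and of the quadratic part.\<close>
lemma sum_splits:
  assumes "m \<ge> 1"
  shows "(\<Sum>i\<le>m. h (m - i) i) = h 0 m + h m 0 + (\<Sum>(i, j)\<in>splits m. h i j)"
proof -
  have "splits m = (\<lambda>i. (m - i, i)) ` {0<..<m}"
    by (force simp: splits_def)
  moreover have "inj_on (\<lambda>i. (m - i, i)) {0<..<m}"
    by (auto simp: inj_on_def)
  ultimately have "(\<Sum>(i, j)\<in>splits m. h i j) = (\<Sum>i\<in>{0<..<m}. h (m - i) i)"
    by (simp add: sum.reindex)
  moreover have "{..m} = insert 0 (insert m {0<..<m})" using assms by auto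
  ultimately show ?thesis using assms by (simp add: add_ac)
qed

lemma quad_cong:
  assumes "\<And>i. 0 < i \<Longrightarrow> i < m \<Longrightarrow> F i = F' i" and "\<And>i. 0 < i \<Longrightarrow> i < m \<Longrightarrow> G i = G' i"
  shows "quad_P F m = quad_P F' m" "quad_Q F G m = quad_Q F' G' m"
    "quad_R F G m = quad_R F' G' m" "quad_S G m = quad_S G' m"
  unfolding quad_P_def[abs_def] quad_Q_def[abs_def] quad_R_def[abs_def] quad_S_def[abs_def]
  by (intro ext sum.cong refl; auto simp: splits_def assms)+

locale multiadditive_series =
  fixes F :: "nat \<Rightarrow> 'v \<Rightarrow> 'v \<Rightarrow> 'v::ab_group_add"
    and G :: "nat \<Rightarrow> 'v \<Rightarrow> 'v \<Rightarrow> 'v \<Rightarrow> 'v"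
  assumes F1: "additive (\<lambda>x. F i x y)" and F2: "additive (F i x)"
    and G1: "additive (\<lambda>x. G i x y z)" and G2: "additive (\<lambda>y. G i x y z)"
    and G3: "additive (G i x y)"
begin

abbreviation "f \<equiv> ext2 F"
abbreviation "g \<equiv> ext3 G"

lemma coeff_additive:
  "additive (F i)" "additive (F i x)" "additive (series_app F u m)"
  "additive (G i)" "additive (G i x)" "additive (G i x y)"
  "additive (series_app G u m)" "additive (series_app G u m y)"
  "additive (series_app (series_app G u) v m)" "additive (series_app (\<lambda>m. G m x) v m)"
  using F1 F2 G1 G2 G3
  by (auto simp: additive_def series_app_def sum_fun_apply sum.distrib fun_eq_iff)

lemma t_linear_ext:
  assumes "t_linear h"
  shows "t_linear (\<lambda>x. f (h x) b)"
    and "t_linear (\<lambda>x. f a (h x))"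
    and "t_linear (\<lambda>x. g (h x) b c)"
    and "t_linear (\<lambda>x. g a (h x) c)"
    and "t_linear (\<lambda>x. g a b (h x))"
  unfolding t_linear_def
  by (intro conjI additive.intro allI;
      simp add: ext2_def ext3_def t_linearD[OF assms] coeff_additive series_app_add series_app_add_left
        series_app_shift series_app_shift_left)+

text \<open>With all but one argument constant, the iterated convolution sums collapse to a single one.\<close>
lemma ext_const:
  "f (const_series a) y m = (\<Sum>i\<le>m. F (m - i) a (y i))"
  "f x (const_series b) m = (\<Sum>i\<le>m. F (m - i) (x i) b)"
  "g (const_series a) (const_series b) z m = (\<Sum>i\<le>m. G (m - i) a b (z i))"
  "g (const_series a) y (const_series c) m = (\<Sum>i\<le>m. G (m - i) a (y i) c)"
  "g x (const_series b) (const_series c) m = (\<Sum>i\<le>m. G (m - i) (x i) b c)"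
  by (simp_all add: ext2_def ext3_def series_app_const coeff_additive)
    (simp_all add: series_app_def sum_fun_apply)

lemma ext_const_const:
  "f (const_series a) (const_series b) = (\<lambda>m. F m a b)"
  "g (const_series a) (const_series b) (const_series c) = (\<lambda>m. G m a b c)"
  by (simp_all add: ext2_def ext3_def series_app_const coeff_additive)

lemma F_G_zero: "F i 0 y = 0" "F i x 0 = 0" "G i 0 y z = 0" "G i x 0 z = 0" "G i x y 0 = 0"
  using F1 F2 G1 G2 G3 by (blast dest: additive.zero)+

lemma ext_lowest:
  assumes "\<And>m. m \<le> n \<Longrightarrow> z m = 0"
  shows "f (const_series a) z (Suc n) = F 0 a (z (Suc n))"
    and "f z (const_series b) (Suc n) = F 0 (z (Suc n)) b"
    and "g (const_series a) (const_series b) z (Suc n) = G 0 a b (z (Suc n))"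
    and "g (const_series a) z (const_series c) (Suc n) = G 0 a (z (Suc n)) c"
    and "g z (const_series b) (const_series c) (Suc n) = G 0 (z (Suc n)) b c"
  by (simp_all add: ext_const assms F_G_zero)

definition LY5_defect where "LY5_defect a b c d = leibniz2 (g a b) f c d"
definition LY6_defect where "LY6_defect a b c d e = leibniz3 (g a b) g c d e"

abbreviation "LY5_coeff m a b c d \<equiv>
  LY5_defect (const_series a) (const_series b) (const_series c) (const_series d) m"
abbreviation "LY6_coeff m a b c d e \<equiv>
  LY6_defect (const_series a) (const_series b) (const_series c) (const_series d) (const_series e) m"

text \<open>The defects must be evaluated at arguments such as \<open>g(a, b, c)\<close> that are not constant; linearity in
  each argument separately reduces this to constants by means of \<open>t_linear_lowest_coeff\<close>.\<close>
lemma t_linear_defect: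
  assumes "t_linear h"
  shows "t_linear (\<lambda>x. LY5_defect (h x) b c d)" "t_linear (\<lambda>x. LY5_defect a (h x) c d)"
    "t_linear (\<lambda>x. LY5_defect a b (h x) d)" "t_linear (\<lambda>x. LY5_defect a b c (h x))"
    "t_linear (\<lambda>x. LY6_defect (h x) b c d e)" "t_linear (\<lambda>x. LY6_defect a (h x) c d e)"
    "t_linear (\<lambda>x. LY6_defect a b (h x) d e)" "t_linear (\<lambda>x. LY6_defect a b c (h x) e)"
    "t_linear (\<lambda>x. LY6_defect a b c d (h x))"
  unfolding LY5_defect_def LY6_defect_def leibniz2_def leibniz3_def
  by (intro t_linear_diff t_linear_ext assms)+

lemma LY5_coeff_sum: "LY5_coeff m a b c d =
    (\<Sum>i\<le>m. G (m - i) a b (F i c d) - F (m - i) (G i a b c) d - F (m - i) c (G i a b d))"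
  by (simp add: LY5_defect_def leibniz2_def ext_const ext_const_const sum_subtractf)

lemma LY6_coeff_sum: "LY6_coeff m a b c d e =
    (\<Sum>i\<le>m. G (m - i) a b (G i c d e) - G (m - i) (G i a b c) d e
      - G (m - i) c (G i a b d) e - G (m - i) c d (G i a b e))"
  by (simp add: LY6_defect_def leibniz3_def ext_const ext_const_const sum_subtractf)

lemma additive_ext:
  "additive (\<lambda>x. f x b)" "additive (f a)"
  "additive (\<lambda>x. g x b c)" "additive (\<lambda>x. g a x c)" "additive (g a b)"
  using t_linear_ext[OF t_linear_ident] unfolding t_linear_def by blast+

text \<open>The defect of LY6 read as an operator on its last argument: it is the curvature of
  \<open>(a, b) \<mapsto> g(a, b, -)\<close>.\<close>
lemma ext_commutator:
  "g a b (g c d v) - g c d (g a b v) = g (g a b c) d v + g c (g a b d) v + LY6_defect a b c d v"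
  by (simp add: LY6_defect_def leibniz3_def)

text \<open>An analogue of the Bianchi identity: express the action of the commutator of \<open>g(a, b, -)\<close> and
  \<open>g(c, d, -)\<close> on \<open>f\<close> in two ways, by the representation property and by \<open>ext_commutator\<close>.\<close>
lemma LY5_defect_identity:
  "leibniz2 (g a b) (LY5_defect c d) x y - leibniz2 (g c d) (LY5_defect a b) x y =
     LY5_defect (g a b c) d x y + LY5_defect c (g a b d) x y + leibniz2 (LY6_defect a b c d) f x y"
proof -
  have "leibniz2 (g a b) (LY5_defect c d) x y - leibniz2 (g c d) (LY5_defect a b) x y =
    leibniz2 (\<lambda>v. g a b (g c d v) - g c d (g a b v)) f x y"
    using leibniz2_commutator[of "g a b" "g c d" f x y] additive_ext
    by (simp add: LY5_defect_def[abs_def])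
  also have "\<dots> = LY5_defect (g a b c) d x y + LY5_defect c (g a b d) x y
      + leibniz2 (LY6_defect a b c d) f x y"
    by (simp add: ext_commutator leibniz2_def LY5_defect_def
        additive.add[OF additive_ext(1)] additive.add[OF additive_ext(2)])
  finally show ?thesis .
qed

text \<open>The same argument with the action on \<open>g\<close> in place of \<open>f\<close>.\<close>
lemma LY6_defect_identity:
  "leibniz3 (g a b) (LY6_defect c d) x y z - leibniz3 (g c d) (LY6_defect a b) x y z =
     LY6_defect (g a b c) d x y z + LY6_defect c (g a b d) x y z
     + leibniz3 (LY6_defect a b c d) g x y z"
proof -
  have "leibniz3 (g a b) (LY6_defect c d) x y z - leibniz3 (g c d) (LY6_defect a b) x y z =
    leibniz3 (\<lambda>v. g a b (g c d v) - g c d (g a b v)) g x y z"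
    using leibniz3_commutator[of "g a b" "g c d" g x y z] additive_ext
    by (simp add: LY6_defect_def[abs_def])
  also have "\<dots> = leibniz3 (g (g a b c) d) g x y z + leibniz3 (g c (g a b d)) g x y z
      + leibniz3 (LY6_defect a b c d) g x y z"
    by (simp add: ext_commutator leibniz3_def additive.add[OF additive_ext(3)]
        additive.add[OF additive_ext(4)] additive.add[OF additive_ext(5)])
  finally show ?thesis by (simp add: LY6_defect_def)
qed

text \<open>The lowest order at which a defect may be nonzero. There, each term of the two identities is a
  product of the leading coefficient of one defect with the constant term \<open>F 0\<close> or \<open>G 0\<close> of an
  operation.\<close>
context
  fixes n
  assumes LY5_low: "\<forall>m\<le>n. \<forall>a b c d. LY5_coeff m a b c d = 0"
    and LY6_low: "\<forall>m\<le>n. \<forall>a b c d e. LY6_coeff m a b c d e = 0"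
begin

lemmas R0 = LY5_low[rule_format] and S0 = LY6_low[rule_format]

text \<open>The nonconstant arguments of the defects in the two identities are values of \<open>g\<close>, and once of \<open>f\<close>,
  at constant arguments; their constant terms are values of \<open>G 0\<close> and \<open>F 0\<close>.\<close>
lemmas defect_lowest =
  t_linear_lowest_coeff[OF t_linear_defect(1)[OF t_linear_ident] R0,
    where x = "\<lambda>m. G m u v w" for u v w]
  t_linear_lowest_coeff[OF t_linear_defect(2)[OF t_linear_ident] R0,
    where x = "\<lambda>m. G m u v w" for u v w]
  t_linear_lowest_coeff[OF t_linear_defect(3)[OF t_linear_ident] R0,
    where x = "\<lambda>m. G m u v w" for u v w]
  t_linear_lowest_coeff[OF t_linear_defect(4)[OF t_linear_ident] R0,
    where x = "\<lambda>m. G m u v w" for u v w]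
  t_linear_lowest_coeff[OF t_linear_defect(5)[OF t_linear_ident] S0,
    where x = "\<lambda>m. G m u v w" for u v w]
  t_linear_lowest_coeff[OF t_linear_defect(6)[OF t_linear_ident] S0,
    where x = "\<lambda>m. G m u v w" for u v w]
  t_linear_lowest_coeff[OF t_linear_defect(7)[OF t_linear_ident] S0,
    where x = "\<lambda>m. G m u v w" for u v w]
  t_linear_lowest_coeff[OF t_linear_defect(8)[OF t_linear_ident] S0,
    where x = "\<lambda>m. G m u v w" for u v w]
  t_linear_lowest_coeff[OF t_linear_defect(9)[OF t_linear_ident] S0,
    where x = "\<lambda>m. G m u v w" for u v w]
  t_linear_lowest_coeff[OF t_linear_defect(9)[OF t_linear_ident] S0,
    where x = "\<lambda>m. F m u v" for u v]

lemma LY5_coeff_cocycle: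
  defines "R \<equiv> LY5_coeff (Suc n)" and "S \<equiv> LY6_coeff (Suc n)"
  shows "G 0 a b (R c d x y) - R c d (G 0 a b x) y - R c d x (G 0 a b y)
     - (G 0 c d (R a b x y) - R a b (G 0 c d x) y - R a b x (G 0 c d y)) =
     R (G 0 a b c) d x y + R c (G 0 a b d) x y
     + (S a b c d (F 0 x y) - F 0 (S a b c d x) y - F 0 x (S a b c d y))"
  using fun_cong[OF LY5_defect_identity[of "const_series a" "const_series b" "const_series c"
        "const_series d" "const_series x" "const_series y"], of "Suc n"]
  by (simp only: R_def S_def leibniz2_def defect_lowest ext_lowest R0 S0 ext_const_const
      plus_fun_apply fun_diff_def)

lemma LY6_coeff_cocycle:
  defines "S \<equiv> LY6_coeff (Suc n)"
  shows "G 0 a b (S c d x y z) - S c d (G 0 a b x) y z - S c d x (G 0 a b y) z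
       - S c d x y (G 0 a b z)
     - (G 0 c d (S a b x y z) - S a b (G 0 c d x) y z - S a b x (G 0 c d y) z
       - S a b x y (G 0 c d z)) =
     S (G 0 a b c) d x y z + S c (G 0 a b d) x y z
     + (S a b c d (G 0 x y z) - G 0 (S a b c d x) y z - G 0 x (S a b c d y) z
       - G 0 x y (S a b c d z))"
  using fun_cong[OF LY6_defect_identity[of "const_series a" "const_series b" "const_series c"
        "const_series d" "const_series x" "const_series y" "const_series z"], of "Suc n"]
  by (simp only: S_def leibniz3_def defect_lowest ext_lowest S0 ext_const_const
      plus_fun_apply fun_diff_def)

end

text \<open>The skew-symmetry of the constant term reconciles the signs: in \<open>\<delta>\<close> the arguments of the undeformed
  operation are partly interchanged.\<close>
lemma LY5_coeff_eq:
  assumes "m \<ge> 1" and "\<And>x y. F 0 x y = - F 0 y x"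
  shows "LY5_coeff m a b c d = quad_R F G m a b c d + dI_23 (F 0) (G 0) (F m) (G m) a b c d"
  unfolding LY5_coeff_sum sum_splits[OF assms(1), of "\<lambda>i j. G i a b (F j c d)
      - F i (G j a b c) d - F i c (G j a b d)"]
  by (simp add: quad_R_def dI_23_def assms(2)[of _ d] algebra_simps)

lemma LY6_coeff_eq:
  assumes "m \<ge> 1" and "\<And>x y z. G 0 x y z = - G 0 y x z"
  shows "LY6_coeff m a b c d e = quad_S G m a b c d e + dII_23 (G 0) (G m) a b c d e"
  unfolding LY6_coeff_sum sum_splits[OF assms(1), of "\<lambda>i j. G i a b (G j c d e) - G i (G j a b c) d e
      - G i c (G j a b d) e - G i c d (G j a b e)"]
  by (simp add: quad_S_def dII_23_def assms(2)[of c] algebra_simps)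

end

section \<open>The quadratic expressions are cochains\<close>

context vector_space
begin

lemma linear_closure:
  shows "Vector_Spaces.linear scale scale (\<lambda>x. 0)"
    and "Vector_Spaces.linear scale scale h \<Longrightarrow> Vector_Spaces.linear scale scale k \<Longrightarrow>
      Vector_Spaces.linear scale scale (\<lambda>x. h x + k x)"
    and "Vector_Spaces.linear scale scale h \<Longrightarrow> Vector_Spaces.linear scale scale k \<Longrightarrow>
      Vector_Spaces.linear scale scale (\<lambda>x. h x - k x)"
  by (auto simp: Vector_Spaces.linear_iff vector_space_axioms scale_right_distrib
      scale_right_diff_distrib)

lemma linear_sum:
  assumes "\<And>p. p \<in> I \<Longrightarrow> Vector_Spaces.linear scale scale (h p)"
  shows "Vector_Spaces.linear scale scale (\<lambda>x. \<Sum>p\<in>I. h p x)"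
  using assms
  by (induction I rule: infinite_finite_induct) (auto intro!: linear_closure)

lemma linear_cochain2:
  assumes "f \<in> C2 scale" and "Vector_Spaces.linear scale scale h"
  shows "Vector_Spaces.linear scale scale (\<lambda>x. f (h x) b)"
    and "Vector_Spaces.linear scale scale (\<lambda>x. f a (h x))"
  using assms by (simp_all add: C2_def mlin2_def Vector_Spaces.linear_iff)

lemma linear_cochain3:
  assumes "g \<in> C3 scale" and "Vector_Spaces.linear scale scale h"
  shows "Vector_Spaces.linear scale scale (\<lambda>x. g (h x) b c)"
    and "Vector_Spaces.linear scale scale (\<lambda>x. g a (h x) c)"
    and "Vector_Spaces.linear scale scale (\<lambda>x. g a b (h x))"
  using assms by (simp_all add: C3_def mlin3_def mlin2_def Vector_Spaces.linear_iff)

lemma linear_ident: "Vector_Spaces.linear scale scale (\<lambda>x. x)"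
  by (simp add: Vector_Spaces.linear_iff vector_space_axioms)

lemma additive_cochain2:
  assumes "f \<in> C2 scale"
  shows "additive (\<lambda>x. f x b)" "additive (f a)"
  using assms by (simp_all add: C2_def mlin2_def Vector_Spaces.linear_iff additive_def)

lemma additive_cochain3:
  assumes "g \<in> C3 scale"
  shows "additive (\<lambda>x. g x b c)" "additive (\<lambda>x. g a x c)" "additive (g a b)"
  using assms by (simp_all add: C3_def mlin3_def mlin2_def Vector_Spaces.linear_iff additive_def)

lemma alternating_cochain:
  "f \<in> C2 scale \<Longrightarrow> f x x = 0" "g \<in> C3 scale \<Longrightarrow> g x x z = 0"
  by (simp_all add: C2_def C3_def)

lemma skew_cochain:
  shows "f \<in> C2 scale \<Longrightarrow> f y x = - f x y" and "g \<in> C3 scale \<Longrightarrow> g y x z = - g x y z"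
proof -
  have skew: "h y x = - h x y"
    if "\<And>y. additive (\<lambda>x. h x y)" "\<And>x. additive (h x)" "\<And>x. h x x = 0" for h x y
  proof -
    have "h y x + h x y = h (x + y) (x + y)"
      unfolding additive.add[OF that(1)] additive.add[OF that(2)]
      by (simp add: that(3) add.commute)
    then show ?thesis by (simp only: that(3) eq_neg_iff_add_eq_0)
  qed
  show "f y x = - f x y" if "f \<in> C2 scale"
    by (rule skew) (use that in \<open>simp_all add: additive_cochain2 alternating_cochain\<close>)
  show "g y x z = - g x y z" if "g \<in> C3 scale"
    by (rule skew[of "\<lambda>x y. g x y z"]) (use that in \<open>simp_all add: additive_cochain3 alternating_cochain\<close>)
qed

lemma quad_cochains:
  assumes F: "\<And>i. 0 < i \<Longrightarrow> i < m \<Longrightarrow> F i \<in> C2 scale"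
    and G: "\<And>i. 0 < i \<Longrightarrow> i < m \<Longrightarrow> G i \<in> C3 scale"
  shows "(quad_P F m, quad_Q F G m) \<in> C34 scale" and "(quad_R F G m, quad_S G m) \<in> C45 scale"
proof -
  note lin = linear_sum linear_closure linear_cochain2[OF F] linear_cochain3[OF G] linear_ident
  have index: "0 < fst p \<and> fst p < m \<and> 0 < snd p \<and> snd p < m" if "p \<in> splits m" for p
    using that by (auto simp: splits_def)
  note quad = quad_P_def[abs_def] quad_Q_def[abs_def] quad_R_def[abs_def] quad_S_def[abs_def]
    cyclic_sum_def case_prod_unfold
  have skew_F_G: "\<And>i j a b c. 0 < i \<Longrightarrow> i < m \<Longrightarrow> F i c (G j a b c) = - F i (G j a b c) c"
    by (rule skew_cochain(1)[OF F])
  have "mlin3 scale (quad_P F m)" "mlin4 scale (quad_Q F G m)"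
    "mlin4 scale (quad_R F G m)" "mlin5 scale (quad_S G m)"
    unfolding mlin5_def mlin4_def mlin3_def mlin2_def quad
    by (intro conjI allI lin; simp add: index)+
  moreover
  note alternating = alternating_cochain(1)[OF F] alternating_cochain(2)[OF G]
  note zero = additive_cochain2[OF F, THEN additive.zero] additive_cochain3[OF G, THEN additive.zero]
  note minus = additive_cochain2[OF F, THEN additive.minus] additive_cochain3[OF G, THEN additive.minus]
  \<comment> \<open>The terms that are not zero by themselves cancel in pairs, as in
    \<open>F\<^sub>i(F\<^sub>j(a, c), a) + F\<^sub>i(F\<^sub>j(c, a), a) = 0\<close>.\<close>
  have "quad_P F m a a c = 0" "quad_Q F G m a a c d = 0"
    "quad_R F G m a a c d = 0" "quad_R F G m a b c c = 0"
    "quad_S G m a a c d e = 0" "quad_S G m a b c c e = 0" for a b c d e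
    unfolding quad
    using index skew_cochain(1)[OF F, of _ c a] skew_F_G skew_cochain(2)[OF G, of _ c]
    by (auto intro!: sum.neutral simp: alternating zero minus)
  ultimately show "(quad_P F m, quad_Q F G m) \<in> C34 scale" "(quad_R F G m, quad_S G m) \<in> C45 scale"
    by (auto simp: C34_def C45_def C3_def C4_star_def C4_def C5_def)
qed

lemma C23_closed:
  "0 \<in> C23 scale"
  "c \<in> C23 scale \<Longrightarrow> d \<in> C23 scale \<Longrightarrow> c + d \<in> C23 scale"
  "c \<in> C23 scale \<Longrightarrow> - c \<in> C23 scale"
  by (auto simp: C23_def C2_def C3_def mlin3_def mlin2_def Vector_Spaces.linear_iff zero_prod_def
      plus_prod_def uminus_prod_def vector_space_axioms scale_right_distrib)

end

section \<open>The obstruction class\<close>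

definition differential where
  "differential br tr c = (delta_star br tr c, delta_23 br tr c)"

lemma coset_eq_subgroup_iff:
  fixes B :: "'a::ab_group_add set"
  assumes "0 \<in> B" "\<And>x y. x \<in> B \<Longrightarrow> y \<in> B \<Longrightarrow> x + y \<in> B" "\<And>x. x \<in> B \<Longrightarrow> - x \<in> B"
  shows "x +o B = 0 +o B \<longleftrightarrow> x \<in> B"
proof
  assume "x +o B = 0 +o B"
  with set_plus_intro2[OF assms(1), of x] show "x \<in> B" by simp
next
  assume "x \<in> B"
  then have "y \<in> x +o B" if "y \<in> B" for y
    using set_minus_imp_plus[of y x B] assms(2)[OF that assms(3)[of x]] by simp
  with \<open>x \<in> B\<close> show "x +o B = 0 +o B"
    using assms(2) by (auto simp: elt_set_plus_def)
qed

context lie_yamaguti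
begin

lemma additive_br_tr:
  "additive (\<lambda>x. br x b)" "additive (br a)"
  "additive (\<lambda>x. tr x b c)" "additive (\<lambda>x. tr a x c)" "additive (tr a b)"
  using br_bilinear tr_trilinear by (simp_all add: mlin3_def mlin2_def Vector_Spaces.linear_iff additive_def)

lemma additive_differential: "additive (differential br tr)"
proof
  fix c c' :: "('v \<Rightarrow> 'v \<Rightarrow> 'v) \<times> ('v \<Rightarrow> 'v \<Rightarrow> 'v \<Rightarrow> 'v)"
  show "differential br tr (c + c') = differential br tr c + differential br tr c'"
    by (cases c; cases c')
      (simp add: differential_def delta_star_def delta_23_def dI_star_def dII_star_def dI_23_def
        dII_23_def fun_eq_iff additive_br_tr[THEN additive.add] algebra_simps)
qed

text \<open>The coboundaries form a subgroup, so the sign can be chosen as in the deformation equations.\<close>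
lemma trivial_class_iff:
  "cohomology_class s br tr x = cohomology_class s br tr 0 \<longleftrightarrow> (\<exists>c\<in>C23 s. x = - differential br tr c)"
proof -
  let ?B = "coboundaries s br tr"
  have B: "?B = differential br tr ` C23 s"
    by (simp add: coboundaries_def differential_def)
  note d = additive.zero[OF additive_differential] additive.add[OF additive_differential, symmetric]
    additive.minus[OF additive_differential, symmetric]
  have "0 \<in> ?B" "y \<in> ?B \<Longrightarrow> z \<in> ?B \<Longrightarrow> y + z \<in> ?B" "y \<in> ?B \<Longrightarrow> - y \<in> ?B" for y z
    unfolding B using C23_closed d by (force simp: d)+
  then have "cohomology_class s br tr x = cohomology_class s br tr 0 \<longleftrightarrow> x \<in> ?B"
    unfolding cohomology_class_def by (rule coset_eq_subgroup_iff)
  also have "\<dots> \<longleftrightarrow> (\<exists>c\<in>C23 s. x = - differential br tr c)"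
    unfolding B using C23_closed(3) d(3) by (metis (no_types, lifting) image_iff minus_minus)
  finally show ?thesis .
qed

text \<open>The quadratic expressions of order at most \<open>n + 1\<close> do not involve the new cochains, so the equations
  up to order \<open>n\<close> are inherited and only the one of order \<open>n + 1\<close> is a condition on \<open>(f, g)\<close>.\<close>
lemma deformation_extend_iff:
  assumes "deformation s br tr n F G"
  shows "deformation s br tr (n + 1) (F(n + 1 := f)) (G(n + 1 := g)) \<longleftrightarrow>
    (f, g) \<in> C23 s \<and>
    ((quad_P F (n + 1), quad_Q F G (n + 1)), (quad_R F G (n + 1), quad_S G (n + 1))) =
      - differential br tr (f, g)"
proof -
  let ?F = "F(n + 1 := f)" and ?G = "G(n + 1 := g)"
  have cong: "quad_P ?F \<nu> = quad_P F \<nu>" "quad_Q ?F ?G \<nu> = quad_Q F G \<nu>"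
    "quad_R ?F ?G \<nu> = quad_R F G \<nu>" "quad_S ?G \<nu> = quad_S G \<nu>" if "\<nu> \<le> n + 1" for \<nu>
    using that by (intro quad_cong; simp)+
  have "{1..n + 1} = insert (n + 1) {1..n}" by auto
  with assms show ?thesis
    unfolding deformation_def
    by (simp add: cong[simplified] differential_def delta_star_def delta_23_def fun_eq_iff
        uminus_prod_def)
qed

text \<open>Prolong the deformation by zero to a power series of operations with constant terms \<open>br\<close> and \<open>tr\<close>.
  Its LY5 and LY6 defects vanish at order \<open>0\<close> by the axioms and at the orders \<open>1, \<dots>, n\<close> by the
  deformation equations; at order \<open>n + 1\<close> the linear part is zero, which leaves the obstruction.\<close>
lemma obstruction_cocycle:
  assumes "deformation s br tr n F G"
  shows "((quad_P F (n + 1), quad_Q F G (n + 1)), (quad_R F G (n + 1), quad_S G (n + 1)))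
    \<in> cocycles s br tr"
proof -
  have FG: "F i \<in> C2 s" "G i \<in> C3 s" if "0 < i" "i < n + 1" for i
    using assms that by (auto simp: deformation_def C23_def)
  define F' where "F' i = (if i = 0 then br else if i \<le> n then F i else 0)" for i
  define G' where "G' i = (if i = 0 then tr else if i \<le> n then G i else 0)" for i
  interpret D: multiadditive_series F' G'
  proof (rule multiadditive_series.intro)
    fix i x y z
    show "additive (\<lambda>x. F' i x y)" "additive (F' i x)" "additive (\<lambda>x. G' i x y z)"
      "additive (\<lambda>y. G' i x y z)" "additive (G' i x y)"
      using additive_cochain2[OF FG(1)] additive_cochain3[OF FG(2)] additive_br_tr
      by (auto simp: F'_def G'_def) (auto simp: additive_def)
  qed
  have F'0: "F' 0 = br" and G'0: "G' 0 = tr" by (simp_all add: F'_def G'_def)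
  have cong: "quad_R F' G' m = quad_R F G m" "quad_S G' m = quad_S G m" if "m \<le> n + 1" for m
    using that by (intro quad_cong; simp add: F'_def G'_def)+
  have R: "D.LY5_coeff m a b c d = quad_R F G m a b c d + dI_23 br tr (F' m) (G' m) a b c d"
    and S: "D.LY6_coeff m a b c d e = quad_S G m a b c d e + dII_23 tr (G' m) a b c d e"
    if "1 \<le> m" "m \<le> n + 1" for m a b c d e
    using D.LY5_coeff_eq[of m, unfolded F'0 G'0, OF that(1) LY1]
      D.LY6_coeff_eq[of m, unfolded G'0, OF that(1) LY2] cong[OF that(2)]
    by simp_all
  have low: "\<forall>m\<le>n. \<forall>a b c d. D.LY5_coeff m a b c d = 0"
    "\<forall>m\<le>n. \<forall>a b c d e. D.LY6_coeff m a b c d e = 0"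
  proof (safe)
    fix m a b c d e assume that: "m \<le> n"
    show "D.LY5_coeff m a b c d = 0"
    proof (cases "m = 0")
      case True
      then show ?thesis by (simp add: D.LY5_coeff_sum F'0 G'0 LY5)
    next
      case False
      then show ?thesis using assms that by (simp add: R deformation_def F'_def G'_def)
    qed
    show "D.LY6_coeff m a b c d e = 0"
    proof (cases "m = 0")
      case True
      then show ?thesis using LY6[of a b c d e] by (simp add: D.LY6_coeff_sum G'0)
    next
      case False
      then show ?thesis using assms that by (simp add: S deformation_def G'_def)
    qed
  qed
  have top: "D.LY5_coeff (Suc n) a b c d = quad_R F G (Suc n) a b c d"
    "D.LY6_coeff (Suc n) a b c d e = quad_S G (Suc n) a b c d e" for a b c d e
    by (simp_all add: R S F'_def G'_def dI_23_def dII_23_def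
        additive_br_tr[THEN additive.zero])
  \<comment> \<open>In each component of \<open>\<delta>\<close>, one term has its value of \<open>S\<close> in the other slot of the undeformed
    operation than in the identity; LY1 and LY2 interchange the slots.\<close>
  have "dI_45 br tr (quad_R F G (n + 1)) (quad_S G (n + 1)) a b c d x y = 0" for a b c d x y
    using D.LY5_coeff_cocycle[OF low, of a b c d x y, unfolded top F'0 G'0]
    unfolding dI_45_def LY1[of y "quad_S G (n + 1) a b c d x"] by (simp add: algebra_simps)
  moreover have "dII_45 tr (quad_S G (n + 1)) a b c d x y z = 0" for a b c d x y z
    using D.LY6_coeff_cocycle[OF low, of a b c d x y z, unfolded top G'0]
    unfolding dII_45_def LY2[of "quad_S G (n + 1) a b c d y" x] by (simp add: algebra_simps)
  ultimately show ?thesis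
    using quad_cochains[OF FG] by (simp add: cocycles_def delta_45_def fun_eq_iff zero_prod_def)
qed

end

theorem theorem4p3:
  fixes s :: "'k::{alg_closed_field, field_char_0} \<Rightarrow> 'v::ab_group_add \<Rightarrow> 'v"
    and br :: "'v \<Rightarrow> 'v \<Rightarrow> 'v"
    and tr :: "'v \<Rightarrow> 'v \<Rightarrow> 'v \<Rightarrow> 'v"
    and n :: nat
    and F :: "nat \<Rightarrow> 'v \<Rightarrow> 'v \<Rightarrow> 'v"
    and G :: "nat \<Rightarrow> 'v \<Rightarrow> 'v \<Rightarrow> 'v \<Rightarrow> 'v"
  assumes "lie_yamaguti s br tr"
    and "n \<ge> 1"
    and "deformation s br tr n F G"
  defines "obs \<equiv> ((quad_P F (n + 1), quad_Q F G (n + 1)), (quad_R F G (n + 1), quad_S G (n + 1)))"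
  shows "obs \<in> cocycles s br tr \<and>
    (cohomology_class s br tr obs = cohomology_class s br tr 0 \<longleftrightarrow>
     (\<exists>f g. (f, g) \<in> C23 s \<and>
        deformation s br tr (n + 1) (F(n + 1 := f)) (G(n + 1 := g))))"
proof -
  interpret lie_yamaguti s br tr by fact
  show ?thesis
    using obstruction_cocycle[OF assms(3)]
    by (simp add: obs_def trivial_class_iff deformation_extend_iff[OF assms(3)] Bex_def
        del: One_nat_def add_Suc_right)
qed

end
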